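(* Let $P(z)=\sum_{n=0}^{\infty} n!\,z^n$, $S(z)=\sum_{n=1}^{\infty}\mathfrak{s}_n z^n$ and $N(z)=\sum_{n=1}^{\infty}\mathfrak{n}_n z^n$ be the (formal power series) generating functions of all, of self-overlapping, and of non-self-overlapping permutations, respectively. Then \[ N(z)=P(z)\big(1-N(z^2)\big)-1 \] and \[ S(z)=\frac{1+N(z)}{1-N(z^2)}\cdot N(z^2). \]
   Context: $S_n$ denotes the set of permutations $\sigma=\sigma_1\ldots\sigma_n$ of $\{1,\ldots,n\}$. Two sequences of distinct integers $\pi_1\ldots\pi_k$ and $\tau_1\ldots\tau_k$ are isomorphic if $\pi_i>\pi_j\Leftrightarrow\tau_i>\tau_j$ for all $i,j$. A permutation $\sigma\in S_n$, $n\geqslant1$, is self-overlapping if there is an integer $1\leqslant k<n$ such that: (1) $\{1,\ldots,k\}$ is invariant under $\sigma$; (2) $\{n-k+1,\ldots,n\}$ is invariant under $\sigma$; (3) $\sigma_1\ldots\sigma_k$ and $\sigma_{n-k+1}\ldots\sigma_n$ are isomorphic. Otherwise $\sigma$ is non-self-overlapping. For $n\geqslant1$, $\mathfrak{s}_n$ and $\mathfrak{n}_n$ denote the numbers of self-overlapping and non-self-overlapping permutations in $S_n$, respectively. The empty permutation is considered neither self-overlapping nor non-self-overlapping. *)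

theory Defs
  imports "HOL-Combinatorics.Permutations" "HOL-Computational_Algebra.Formal_Power_Series"
begin

text \<open>A permutation \<open>\<sigma> \<in> S\<^sub>n\<close> is a function with \<open>\<sigma> permutes {1..n}\<close>; its one-line notation is
  \<open>\<sigma> 1, \<dots>, \<sigma> n\<close>. A sequence of length \<open>k\<close> is a function read at the indices \<open>1, \<dots>, k\<close> only.\<close>

definition seq_isomorphic :: "nat \<Rightarrow> (nat \<Rightarrow> 'a::linorder) \<Rightarrow> (nat \<Rightarrow> 'a) \<Rightarrow> bool" where
  "seq_isomorphic k p t \<longleftrightarrow> (\<forall>i\<in>{1..k}. \<forall>j\<in>{1..k}. p i > p j \<longleftrightarrow> t i > t j)"

definition self_overlapping :: "nat \<Rightarrow> (nat \<Rightarrow> nat) \<Rightarrow> bool" where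
  "self_overlapping n \<sigma> \<longleftrightarrow> 1 \<le> n \<and> \<sigma> permutes {1..n} \<and>
     (\<exists>k. 1 \<le> k \<and> k < n \<and>
        \<sigma> ` {1..k} \<subseteq> {1..k} \<and>
        \<sigma> ` {n - k + 1..n} \<subseteq> {n - k + 1..n} \<and>
        seq_isomorphic k \<sigma> (\<lambda>i. \<sigma> (n - k + i)))"

definition non_self_overlapping :: "nat \<Rightarrow> (nat \<Rightarrow> nat) \<Rightarrow> bool" where
  "non_self_overlapping n \<sigma> \<longleftrightarrow> 1 \<le> n \<and> \<sigma> permutes {1..n} \<and> \<not> self_overlapping n \<sigma>"

definition num_self_overlapping :: "nat \<Rightarrow> nat" where
  "num_self_overlapping n = card {\<sigma>. self_overlapping n \<sigma>}"

definition num_non_self_overlapping :: "nat \<Rightarrow> nat" where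
  "num_non_self_overlapping n = card {\<sigma>. non_self_overlapping n \<sigma>}"

text \<open>The generating functions are taken over the rationals so that the library's division of
  formal power series applies.\<close>

definition perm_gf :: "rat fps" where
  "perm_gf = Abs_fps (\<lambda>n. fact n)"

definition self_overlapping_gf :: "rat fps" where
  "self_overlapping_gf = Abs_fps (\<lambda>n. if n = 0 then 0 else of_nat (num_self_overlapping n))"

definition non_self_overlapping_gf :: "rat fps" where
  "non_self_overlapping_gf = Abs_fps (\<lambda>n. if n = 0 then 0 else of_nat (num_non_self_overlapping n))"

end

theory Submission
  imports Defs
begin

text \<open>
  A self-overlapping permutation begins and ends with the same block, just as a bordered word begins
  and ends with the same factor, and it is counted in the same way. The isomorphism
  of the two end blocks in the definition is in fact equality up to translation, since both blocks
  permute an interval (\<open>self_overlapping_iff_border\<close>). So \<open>k\<close> witnesses that \<open>\<sigma>\<close> is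
  self-overlapping exactly when \<open>\<sigma>\<close> maps \<open>{1..k}\<close> to itself and acts on the last \<open>k\<close> positions as
  the translate of its action on the first \<open>k\<close>; such a \<open>k\<close> is called a border here.

  Consider the shortest border \<open>k\<close> of \<open>\<sigma> \<in> S\<^sub>n\<close>. It satisfies \<open>2 k \<le> n\<close>, because end blocks
  that overlap meet in a block whose translates form a shorter border (\<open>border_shorten\<close>).
  Hence \<open>\<sigma>\<close> is a direct
  sum \<open>\<tau> \<oplus> \<rho> \<oplus> \<tau>\<close> with \<open>\<tau> \<in> S\<^sub>k\<close> and \<open>\<rho>\<close> an arbitrary element of \<open>S\<^bsub>n - 2 k\<^esub>\<close>. The borders of
  \<open>\<sigma>\<close> shorter than \<open>k\<close> are precisely the borders of \<open>\<tau>\<close> (\<open>border_restrict_id_iff\<close>), so that \<open>k\<close> is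
  shortest if and only if \<open>\<tau>\<close> is non-self-overlapping. The decomposition is therefore unique, and
  counting it gives \<open>s\<^sub>n = \<Sum> n\<^sub>k (n - 2 k)!\<close> over \<open>k\<close> with \<open>2 \<le> 2 k \<le> n\<close>, that is
  \<open>S(z) = N(z\<^sup>2) P(z)\<close>. Together with \<open>1 + N(z) + S(z) = P(z)\<close>, both formulas follow by
  algebra; \<open>1 - N(z\<^sup>2)\<close> can be cancelled because its constant term is \<open>1\<close>.
\<close>

section \<open>Borders of a permutation\<close>

text \<open>
  Translation by \<open>n - k\<close> carries the invariance of the first \<open>k\<close> positions to the last \<open>k\<close>.
\<close>
definition border :: "nat \<Rightarrow> nat \<Rightarrow> (nat \<Rightarrow> nat) \<Rightarrow> bool" where
  "border n k \<sigma> \<longleftrightarrow> 1 \<le> k \<and> k < n \<and> (\<forall>i\<in>{1..k}. \<sigma> i \<le> k \<and> \<sigma> (n - k + i) = n - k + \<sigma> i)"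

lemma permutes_atLeastAtMost_bounds:
  fixes \<sigma> :: "nat \<Rightarrow> nat"
  assumes "\<sigma> permutes {1..n}" "1 \<le> i" "i \<le> n"
  shows "1 \<le> \<sigma> i" "\<sigma> i \<le> n"
  using permutes_in_image[OF assms(1), of i] assms(2,3) by auto

lemma permutes_invariant_prefix:
  fixes \<sigma> :: "nat \<Rightarrow> nat"
  assumes "\<sigma> permutes {1..n}" "\<And>i. 1 \<le> i \<Longrightarrow> i \<le> k \<Longrightarrow> \<sigma> i \<le> k" "k \<le> n"
  shows "\<sigma> ` {1..k} = {1..k}"
proof (rule card_subset_eq)
  show "\<sigma> ` {1..k} \<subseteq> {1..k}"
    using assms permutes_atLeastAtMost_bounds(1)[OF assms(1)] by fastforce
  show "card (\<sigma> ` {1..k}) = card {1..k}"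
    using permutes_inj_on[OF assms(1)] by (rule card_image)
qed simp

text \<open>
  A bijection of \<open>{1..k}\<close> is determined by the order of its values: \<open>p i\<close> is the rank of \<open>p i\<close>
  among all values, and isomorphic sequences have equal ranks.
\<close>
lemma seq_isomorphic_imp_eq:
  fixes p t :: "nat \<Rightarrow> nat"
  assumes p: "bij_betw p {1..k} {1..k}" and t: "bij_betw t {1..k} {1..k}"
    and iso: "seq_isomorphic k p t" and i: "i \<in> {1..k}"
  shows "p i = t i"
proof -
  have rank: "card {j \<in> {1..k}. f j \<le> f i} = f i" if f: "bij_betw f {1..k} {1..k}" for f :: "nat \<Rightarrow> nat"
  proof -
    have fi: "f i \<in> {1..k}" using f i by (auto simp: bij_betw_def)
    have inj: "inj_on f {j \<in> {1..k}. f j \<le> f i}"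
      using f by (auto simp: bij_betw_def intro: inj_on_subset)
    have "f ` {j \<in> {1..k}. f j \<le> f i} = {y \<in> f ` {1..k}. y \<le> f i}" by auto
    also have "\<dots> = {1..f i}" using f fi by (auto simp: bij_betw_def)
    finally show ?thesis using card_image[OF inj] by simp
  qed
  have "{j \<in> {1..k}. p j \<le> p i} = {j \<in> {1..k}. t j \<le> t i}"
    using iso i unfolding seq_isomorphic_def by (auto simp: not_less[symmetric])
  with rank[OF p] rank[OF t] show ?thesis by simp
qed

text \<open>
  The pattern of the last \<open>k\<close> entries does not change when they are shifted down by \<open>n - k\<close>. Both
  end blocks are then bijections of \<open>{1..k}\<close>, and isomorphism becomes equality.
\<close>
lemma self_overlapping_iff_border:
  "self_overlapping n \<sigma> \<longleftrightarrow> \<sigma> permutes {1..n} \<and> (\<exists>k. border n k \<sigma>)"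
proof (intro iffI conjI)
  assume so: "self_overlapping n \<sigma>"
  then show perm: "\<sigma> permutes {1..n}" by (simp add: self_overlapping_def)
  from so obtain k where k: "1 \<le> k" "k < n"
    and pre: "\<sigma> ` {1..k} \<subseteq> {1..k}" and suf: "\<sigma> ` {n - k + 1..n} \<subseteq> {n - k + 1..n}"
    and iso: "seq_isomorphic k \<sigma> (\<lambda>i. \<sigma> (n - k + i))"
    by (auto simp: self_overlapping_def)
  let ?t = "\<lambda>i. \<sigma> (n - k + i) - (n - k)"
  have inj: "inj \<sigma>" using perm by (rule permutes_inj)
  have suf': "n - k + 1 \<le> \<sigma> (n - k + i)" "\<sigma> (n - k + i) \<le> n" if "i \<in> {1..k}" for i
  proof -
    have "n - k + i \<in> {n - k + 1..n}" using that k by auto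
    with suf have "\<sigma> (n - k + i) \<in> {n - k + 1..n}" by blast
    then show "n - k + 1 \<le> \<sigma> (n - k + i)" "\<sigma> (n - k + i) \<le> n" by auto
  qed
  have "inj_on ?t {1..k}"
  proof (rule inj_onI)
    fix i j assume ij: "i \<in> {1..k}" "j \<in> {1..k}" "?t i = ?t j"
    then have "\<sigma> (n - k + i) = \<sigma> (n - k + j)"
      using suf'(1)[of i] suf'(1)[of j] by linarith
    then show "i = j" using injD[OF inj] by fastforce
  qed
  moreover have "?t ` {1..k} \<subseteq> {1..k}" using suf' k by fastforce
  ultimately have t: "bij_betw ?t {1..k} {1..k}"
    by (simp add: bij_betw_def endo_inj_surj)
  have p: "bij_betw \<sigma> {1..k} {1..k}"
    using pre permutes_inj_on[OF perm] by (simp add: bij_betw_def endo_inj_surj)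
  have iso': "seq_isomorphic k \<sigma> ?t"
    unfolding seq_isomorphic_def
  proof (intro ballI)
    fix i j assume ij: "i \<in> {1..k}" "j \<in> {1..k}"
    then have "\<sigma> j < \<sigma> i \<longleftrightarrow> \<sigma> (n - k + j) < \<sigma> (n - k + i)"
      using iso unfolding seq_isomorphic_def by blast
    also have "\<dots> \<longleftrightarrow> ?t j < ?t i"
      using suf'(1)[OF ij(1)] suf'(1)[OF ij(2)] by linarith
    finally show "\<sigma> j < \<sigma> i \<longleftrightarrow> ?t j < ?t i" .
  qed
  have "\<sigma> i \<le> k \<and> \<sigma> (n - k + i) = n - k + \<sigma> i" if i: "i \<in> {1..k}" for i
  proof
    show "\<sigma> i \<le> k" using pre i by fastforce
    show "\<sigma> (n - k + i) = n - k + \<sigma> i"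
      using seq_isomorphic_imp_eq[OF p t iso' i] suf'(1)[OF i] by linarith
  qed
  with k show "\<exists>k. border n k \<sigma>" unfolding border_def by blast
next
  assume "\<sigma> permutes {1..n} \<and> (\<exists>k. border n k \<sigma>)"
  then obtain k where perm: "\<sigma> permutes {1..n}" and k: "1 \<le> k" "k < n"
    and bd: "\<And>i. 1 \<le> i \<Longrightarrow> i \<le> k \<Longrightarrow> \<sigma> i \<le> k"
    and sh: "\<And>i. 1 \<le> i \<Longrightarrow> i \<le> k \<Longrightarrow> \<sigma> (n - k + i) = n - k + \<sigma> i"
    by (auto simp: border_def)
  have pre: "\<sigma> ` {1..k} = {1..k}" using perm bd k by (intro permutes_invariant_prefix) auto
  have "\<sigma> ` {n - k + 1..n} \<subseteq> {n - k + 1..n}"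
  proof (rule image_subsetI)
    fix x assume x: "x \<in> {n - k + 1..n}"
    define i where "i = x - (n - k)"
    have i: "1 \<le> i" "i \<le> k" "x = n - k + i" using x k by (auto simp: i_def)
    show "\<sigma> x \<in> {n - k + 1..n}"
      using sh[OF i(1,2)] bd[OF i(1,2)] i k permutes_atLeastAtMost_bounds(1)[OF perm i(1)] by auto
  qed
  moreover have "seq_isomorphic k \<sigma> (\<lambda>i. \<sigma> (n - k + i))"
    using sh by (auto simp: seq_isomorphic_def)
  moreover have "1 \<le> n" "\<sigma> ` {1..k} \<subseteq> {1..k}" using k pre by auto
  ultimately show "self_overlapping n \<sigma>"
    using k perm unfolding self_overlapping_def by blast
qed

text \<open>
  With \<open>d = n - k\<close>, a border says that \<open>\<sigma>\<close> commutes with translation by \<open>d\<close> on \<open>{1..k}\<close>. If \<open>d < k\<close>,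
  translating twice relates the first \<open>k - d\<close> positions to the last \<open>k - d\<close>, and the bound
  \<open>\<sigma> (d + i) \<le> k\<close> gives \<open>\<sigma> i \<le> k - d\<close>. Since \<open>k - d = 2 k - n\<close>
  is smaller than \<open>k\<close>, a shortest border is at most half of \<open>n\<close>.
\<close>
lemma border_shorten:
  assumes perm: "\<sigma> permutes {1..n}" and b: "border n k \<sigma>" and long: "n < 2 * k"
  shows "border n (2 * k - n) \<sigma>"
proof -
  define d where "d = n - k"
  have k: "1 \<le> k" "k < n" and n: "n = k + d" and d: "0 < d" "d < k" using b long by (auto simp: border_def d_def)
  have bd: "\<sigma> i \<le> k" and sh: "\<sigma> (d + i) = d + \<sigma> i" if "1 \<le> i" "i \<le> k" for i
    using b that by (auto simp: border_def d_def)
  have "\<sigma> i \<le> k - d \<and> \<sigma> (2 * d + i) = 2 * d + \<sigma> i" if i: "1 \<le> i" "i \<le> k - d" for i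
  proof -
    have "\<sigma> (d + i) \<le> k" "\<sigma> (d + i) = d + \<sigma> i" "\<sigma> (d + (d + i)) = d + \<sigma> (d + i)"
      using bd[of "d + i"] sh[of i] sh[of "d + i"] i d by auto
    then show ?thesis by (simp add: mult_2 add.assoc)
  qed
  moreover have eq: "2 * k - n = k - d" "n - (k - d) = 2 * d" using n d by auto
  ultimately show ?thesis using n d unfolding border_def eq by auto
qed

text \<open>
  The last \<open>j\<close> positions of \<open>\<sigma>\<close> are the translates by \<open>n - k\<close> of the last \<open>j\<close> positions of its
  initial block of length \<open>k\<close>, so either can be compared with the first \<open>j\<close>. This transfers
  minimality of \<open>k\<close> into the absence of borders in that block, and back.
\<close>
lemma border_restrict_id_iff:
  assumes b: "border n k \<sigma>" and j: "j < k"
  shows "border k j (restrict_id \<sigma> {1..k}) \<longleftrightarrow> border n j \<sigma>"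
proof -
  have k: "k < n" using b by (simp add: border_def)
  have "restrict_id \<sigma> {1..k} (k - j + i) = k - j + \<sigma> i \<longleftrightarrow> \<sigma> (n - j + i) = n - j + \<sigma> i"
    if i: "i \<in> {1..j}" for i
  proof -
    have "k - j + i \<in> {1..k}" using i j by auto
    then have "\<sigma> (n - k + (k - j + i)) = n - k + \<sigma> (k - j + i)"
      using b by (auto simp: border_def)
    moreover have "n - k + (k - j + i) = n - j + i" using j k by auto
    ultimately have "\<sigma> (n - j + i) = n - k + \<sigma> (k - j + i)" by simp
    then show ?thesis using i j k by (auto simp: restrict_id_def)
  qed
  moreover have "restrict_id \<sigma> {1..k} i = \<sigma> i" if "i \<in> {1..j}" for i
    using that j by (auto simp: restrict_id_def)
  ultimately show ?thesis using j k by (auto simp: border_def)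
qed

lemma restrict_id_border_permutes:
  fixes \<sigma> :: "nat \<Rightarrow> nat"
  assumes "\<sigma> permutes {1..n}" "border n k \<sigma>"
  shows "restrict_id \<sigma> {1..k} permutes {1..k}"
proof (rule permutes_restrict_id)
  have "\<sigma> ` {1..k} = {1..k}"
    using assms by (intro permutes_invariant_prefix) (auto simp: border_def)
  then show "bij_betw \<sigma> {1..k} {1..k}"
    using permutes_inj_on[OF assms(1)] by (simp add: bij_betw_def)
qed

section \<open>Direct sums with equal outer blocks\<close>

text \<open>
  The direct sum \<open>\<tau> \<oplus> \<rho> \<oplus> \<tau>\<close> of \<open>\<tau> \<in> S\<^sub>k\<close>, \<open>\<rho> \<in> S\<^sub>m\<close> and \<open>\<tau>\<close> again. The first branch includes
  \<open>i = 0\<close>, which \<open>\<tau>\<close> fixes.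
\<close>
definition sandwich :: "nat \<Rightarrow> nat \<Rightarrow> (nat \<Rightarrow> nat) \<Rightarrow> (nat \<Rightarrow> nat) \<Rightarrow> nat \<Rightarrow> nat" where
  "sandwich k m \<tau> \<rho> i =
     (if i \<le> k then \<tau> i
      else if i \<le> k + m then k + \<rho> (i - k)
      else if i \<le> 2 * k + m then k + m + \<tau> (i - (k + m))
      else i)"

lemma sandwich_permutes:
  assumes t: "\<tau> permutes {1..k}" and r: "\<rho> permutes {1..m}"
  shows "sandwich k m \<tau> \<rho> permutes {1..2 * k + m}"
proof (rule inj_imp_permutes)
  note tb = permutes_atLeastAtMost_bounds[OF t] and rb = permutes_atLeastAtMost_bounds[OF r]
  have ti: "\<tau> i = \<tau> j \<Longrightarrow> i = j" and ri: "\<rho> i = \<rho> j \<Longrightarrow> i = j" for i j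
    using permutes_inj[OF t] permutes_inj[OF r] by (auto dest: injD)
  let ?g = "sandwich k m \<tau> \<rho>"
  have low: "?g i = \<tau> i" "1 \<le> \<tau> i" "\<tau> i \<le> k" if "1 \<le> i" "i \<le> k" for i
    using that tb[of i] by (auto simp: sandwich_def)
  have mid: "?g i = k + \<rho> (i - k)" "1 \<le> \<rho> (i - k)" "\<rho> (i - k) \<le> m"
    if "k < i" "i \<le> k + m" for i
    using that rb[of "i - k"] by (auto simp: sandwich_def)
  have high: "?g i = k + m + \<tau> (i - (k + m))" "1 \<le> \<tau> (i - (k + m))" "\<tau> (i - (k + m)) \<le> k"
    if "k + m < i" "i \<le> 2 * k + m" for i
    using that tb[of "i - (k + m)"] by (auto simp: sandwich_def)
  show "?g i \<in> {1..2 * k + m}" if "i \<in> {1..2 * k + m}" for i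
  proof -
    have "1 \<le> i" "i \<le> 2 * k + m" using that by auto
    then consider "1 \<le> i" "i \<le> k" | "k < i" "i \<le> k + m" | "k + m < i" "i \<le> 2 * k + m"
      by linarith
    then show ?thesis
      by cases (use low[of i] mid[of i] high[of i] in simp_all)
  qed
  show "inj_on ?g {1..2 * k + m}"
  proof (rule linorder_inj_onI)
    fix i j :: nat assume ij: "i < j" "i \<in> {1..2 * k + m}" "j \<in> {1..2 * k + m}"
    then consider "1 \<le> i" "i \<le> k" "j \<le> k"
      | "1 \<le> i" "i \<le> k" "k < j" "j \<le> k + m"
      | "1 \<le> i" "i \<le> k" "k + m < j" "j \<le> 2 * k + m"
      | "k < i" "i \<le> k + m" "j \<le> k + m"
      | "k < i" "i \<le> k + m" "k + m < j" "j \<le> 2 * k + m"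
      | "k + m < i" "j \<le> 2 * k + m"
      unfolding atLeastAtMost_iff by linarith
    then show "?g i \<noteq> ?g j"
    proof cases
      case 1 then show ?thesis using low(1)[of i] low(1)[of j] ti[of i j] ij by auto
    next
      case 2 then show ?thesis using low[of i] mid[of j] by linarith
    next
      case 3 then show ?thesis using low[of i] high[of j] by linarith
    next
      case 4 then show ?thesis using mid(1)[of i] mid(1)[of j] ri[of "i - k" "j - k"] ij by auto
    next
      case 5 then show ?thesis using mid[of i] high[of j] by linarith
    next
      case 6 then show ?thesis
        using high(1)[of i] high(1)[of j] ti[of "i - (k + m)" "j - (k + m)"] ij by auto
    qed
  qed auto
  show "sandwich k m \<tau> \<rho> i = i" if "i \<notin> {1..2 * k + m}" for i
    using that permutes_not_in[OF t, of i] by (auto simp: sandwich_def)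
qed simp

lemma border_sandwich:
  assumes "\<tau> permutes {1..k}" "1 \<le> k"
  shows "border (2 * k + m) k (sandwich k m \<tau> \<rho>)"
  using permutes_atLeastAtMost_bounds[OF assms(1)] assms(2) by (auto simp: border_def sandwich_def)

lemma restrict_id_sandwich:
  assumes "\<tau> permutes {1..k}"
  shows "restrict_id (sandwich k m \<tau> \<rho>) {1..k} = \<tau>"
  using permutes_not_in[OF assms] by (auto simp: restrict_id_def sandwich_def fun_eq_iff)

lemma sandwich_middle_inject:
  assumes r: "\<rho> permutes {1..m}" and r': "\<rho>' permutes {1..m}"
    and eq: "sandwich k m \<tau> \<rho> = sandwich k m \<tau> \<rho>'"
  shows "\<rho> = \<rho>'"
proof
  fix i
  show "\<rho> i = \<rho>' i"
  proof (cases "i \<in> {1..m}")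
    case True
    then show ?thesis using fun_cong[OF eq, of "k + i"] by (auto simp: sandwich_def)
  qed (metis permutes_not_in r r')
qed

text \<open>
  The border fixes both outer blocks setwise, so injectivity of \<open>\<sigma>\<close> leaves only the middle interval
  for the values at the middle positions; these give \<open>\<rho>\<close>.
\<close>
lemma obtain_sandwich:
  assumes perm: "\<sigma> permutes {1..2 * k + m}" and b: "border (2 * k + m) k \<sigma>"
  obtains \<rho> where "\<rho> permutes {1..m}" "\<sigma> = sandwich k m (restrict_id \<sigma> {1..k}) \<rho>"
proof
  define \<rho> where "\<rho> i = (if i \<in> {1..m} then \<sigma> (k + i) - k else i)" for i
  have k: "1 \<le> k" using b by (simp add: border_def)
  have bd: "\<sigma> i \<le> k" and sh: "\<sigma> (k + m + i) = k + m + \<sigma> i" if "1 \<le> i" "i \<le> k" for i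
    using b that by (auto simp: border_def)
  have inj: "\<sigma> i = \<sigma> j \<Longrightarrow> i = j" for i j using permutes_inj[OF perm] by (auto dest: injD)
  have pre: "\<sigma> ` {1..k} = {1..k}"
    using perm bd by (intro permutes_invariant_prefix) auto
  have mid: "k < \<sigma> (k + i) \<and> \<sigma> (k + i) \<le> k + m" if i: "1 \<le> i" "i \<le> m" for i
  proof -
    have rng: "1 \<le> \<sigma> (k + i)" "\<sigma> (k + i) \<le> 2 * k + m"
      using permutes_atLeastAtMost_bounds[OF perm, of "k + i"] i by auto
    have "\<not> \<sigma> (k + i) \<le> k"
    proof
      assume "\<sigma> (k + i) \<le> k"
      then have "\<sigma> (k + i) \<in> \<sigma> ` {1..k}" using rng pre by auto
      then show False using inj i by fastforce
    qed
    moreover have "\<not> k + m < \<sigma> (k + i)"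
    proof
      assume "k + m < \<sigma> (k + i)"
      then have "\<sigma> (k + i) - (k + m) \<in> \<sigma> ` {1..k}" using rng pre by auto
      then obtain j where j: "1 \<le> j" "j \<le> k" "\<sigma> (k + i) - (k + m) = \<sigma> j" by auto
      then have "\<sigma> (k + i) = \<sigma> (k + m + j)"
        using sh[OF j(1,2)] \<open>k + m < \<sigma> (k + i)\<close> by simp
      then show False using inj i j by fastforce
    qed
    ultimately show ?thesis by simp
  qed
  show "\<rho> permutes {1..m}"
  proof (rule inj_imp_permutes)
    show "inj_on \<rho> {1..m}"
    proof (rule inj_onI)
      fix i j assume ij: "i \<in> {1..m}" "j \<in> {1..m}" "\<rho> i = \<rho> j"
      then have "\<sigma> (k + i) = \<sigma> (k + j)" using mid[of i] mid[of j] by (auto simp: \<rho>_def)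
      then show "i = j" using inj by fastforce
    qed
    show "\<rho> i \<in> {1..m}" if "i \<in> {1..m}" for i
      using mid[of i] that by (auto simp: \<rho>_def)
  qed (auto simp: \<rho>_def)
  show "\<sigma> = sandwich k m (restrict_id \<sigma> {1..k}) \<rho>"
  proof
    fix i
    consider "i = 0" | "1 \<le> i" "i \<le> k" | "k < i" "i \<le> k + m" | "k + m < i" "i \<le> 2 * k + m"
      | "2 * k + m < i" by linarith
    then show "\<sigma> i = sandwich k m (restrict_id \<sigma> {1..k}) \<rho> i"
    proof cases
      case 3
      then show ?thesis using mid[of "i - k"] by (auto simp: sandwich_def \<rho>_def)
    next
      case 4
      then show ?thesis using sh[of "i - (k + m)"] by (auto simp: sandwich_def restrict_id_def)
    qed (use permutes_not_in[OF perm, of i] in \<open>auto simp: sandwich_def restrict_id_def\<close>)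
  qed
qed

section \<open>Decomposition by the shortest border\<close>

text \<open>
  The length of the outer block can be recovered from the permutation as its shortest border; hence
  sandwiches with outer blocks of different lengths never coincide.
\<close>
lemma border_sandwich_minimal:
  assumes t: "non_self_overlapping k \<tau>" and b: "border (2 * k + m) j (sandwich k m \<tau> \<rho>)"
  shows "k \<le> j"
proof (rule ccontr)
  assume "\<not> k \<le> j"
  have perm: "\<tau> permutes {1..k}" and k: "1 \<le> k" and no: "\<not> border k j \<tau>"
    using t by (auto simp: non_self_overlapping_def self_overlapping_iff_border)
  have "border k j (restrict_id (sandwich k m \<tau> \<rho>) {1..k})"
    using border_restrict_id_iff[OF border_sandwich[OF perm k]] b \<open>\<not> k \<le> j\<close> by simp
  with no show False unfolding restrict_id_sandwich[OF perm] by blast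
qed

lemma self_overlapping_eq_sandwich:
  assumes "self_overlapping n \<sigma>"
  obtains k \<tau> \<rho> where "1 \<le> k" "2 * k \<le> n" "non_self_overlapping k \<tau>" "\<rho> permutes {1..n - 2 * k}"
    "\<sigma> = sandwich k (n - 2 * k) \<tau> \<rho>"
proof -
  have perm: "\<sigma> permutes {1..n}" and ex: "\<exists>k. border n k \<sigma>"
    using assms by (auto simp: self_overlapping_iff_border)
  define k where "k = (LEAST k. border n k \<sigma>)"
  have b: "border n k \<sigma>" unfolding k_def using ex by (rule LeastI_ex)
  have least: "\<not> border n j \<sigma>" if "j < k" for j using that unfolding k_def by (rule not_less_Least)
  have k: "1 \<le> k" "k < n" using b by (auto simp: border_def)
  have short: "2 * k \<le> n"
    using border_shorten[OF perm b] least[of "2 * k - n"] k by linarith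
  then have n: "n = 2 * k + (n - 2 * k)" by simp
  obtain \<rho> where "\<rho> permutes {1..n - 2 * k}" "\<sigma> = sandwich k (n - 2 * k) (restrict_id \<sigma> {1..k}) \<rho>"
    using obtain_sandwich[of \<sigma> k "n - 2 * k"] perm b n by metis
  moreover have "non_self_overlapping k (restrict_id \<sigma> {1..k})"
  proof -
    have "\<not> border k j (restrict_id \<sigma> {1..k})" for j
      using border_restrict_id_iff[OF b, of j] least[of j] by (cases "j < k") (auto simp: border_def)
    then show ?thesis
      using restrict_id_border_permutes[OF perm b] k
      by (simp add: non_self_overlapping_def self_overlapping_iff_border)
  qed
  ultimately show thesis using that k short by blast
qed

lemma finite_non_self_overlapping: "finite {\<tau>. non_self_overlapping n \<tau>}"
  by (rule finite_subset[OF _ finite_permutations[of "{1..n}"]])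
     (auto simp: non_self_overlapping_def)

lemma finite_self_overlapping: "finite {\<tau>. self_overlapping n \<tau>}"
  by (rule finite_subset[OF _ finite_permutations[of "{1..n}"]])
     (auto simp: self_overlapping_def)

text \<open>
  The triples of a length \<open>k\<close>, a non-self-overlapping \<open>\<tau>\<close> and a filling \<open>\<rho>\<close> are in bijection with
  the self-overlapping permutations, by forming the sandwich.
\<close>
lemma num_self_overlapping_eq_sum:
  "num_self_overlapping n =
     (\<Sum>k | 1 \<le> k \<and> 2 * k \<le> n. num_non_self_overlapping k * fact (n - 2 * k))"
proof -
  define K where "K = {k. 1 \<le> k \<and> 2 * k \<le> n}"
  define A where "A k = {\<tau>. non_self_overlapping k \<tau>} \<times> {\<rho>. \<rho> permutes {1..n - 2 * k}}" for k
  have finK: "finite K" by (rule finite_subset[of _ "{..n}"]) (auto simp: K_def)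
  define f where "f = (\<lambda>(k, \<tau>, \<rho>). sandwich k (n - 2 * k) \<tau> \<rho>)"
  have "inj_on f (Sigma K A)"
  proof (rule inj_onI, clarsimp simp: f_def A_def K_def)
    fix k \<tau> \<rho> k' \<tau>' \<rho>'
    assume k: "Suc 0 \<le> k" "2 * k \<le> n" and k': "Suc 0 \<le> k'" "2 * k' \<le> n"
      and t: "non_self_overlapping k \<tau>" and t': "non_self_overlapping k' \<tau>'"
      and r: "\<rho> permutes {Suc 0..n - 2 * k}" and r': "\<rho>' permutes {Suc 0..n - 2 * k'}"
      and eq: "sandwich k (n - 2 * k) \<tau> \<rho> = sandwich k' (n - 2 * k') \<tau>' \<rho>'"
    have p: "\<tau> permutes {1..k}" "\<tau>' permutes {1..k'}"
      using t t' by (auto simp: non_self_overlapping_def)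
    have b: "border n k (sandwich k (n - 2 * k) \<tau> \<rho>)"
      using border_sandwich[OF p(1), of "n - 2 * k" \<rho>] k by simp
    have b': "border n k' (sandwich k' (n - 2 * k') \<tau>' \<rho>')"
      using border_sandwich[OF p(2), of "n - 2 * k'" \<rho>'] k' by simp
    have "k \<le> k'" using border_sandwich_minimal[OF t, of "n - 2 * k" k' \<rho>] b' eq k by simp
    moreover have "k' \<le> k" using border_sandwich_minimal[OF t', of "n - 2 * k'" k \<rho>'] b eq k' by simp
    ultimately have kk: "k = k'" by simp
    moreover have tt: "\<tau> = \<tau>'" using restrict_id_sandwich p eq kk by metis
    ultimately show "k = k' \<and> \<tau> = \<tau>' \<and> \<rho> = \<rho>'"
      using sandwich_middle_inject[of \<rho> "n - 2 * k" \<rho>' k \<tau>] r r' eq by simp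
  qed
  moreover have "f ` Sigma K A = {\<sigma>. self_overlapping n \<sigma>}"
  proof (intro equalityI subsetI)
    fix \<sigma> assume "\<sigma> \<in> f ` Sigma K A"
    then obtain k \<tau> \<rho> where k: "1 \<le> k" "2 * k \<le> n" and t: "non_self_overlapping k \<tau>"
      and r: "\<rho> permutes {1..n - 2 * k}" and \<sigma>: "\<sigma> = sandwich k (n - 2 * k) \<tau> \<rho>"
      by (auto simp: f_def A_def K_def)
    have p: "\<tau> permutes {1..k}" using t by (auto simp: non_self_overlapping_def)
    show "\<sigma> \<in> {\<sigma>. self_overlapping n \<sigma>}"
      using sandwich_permutes[OF p r] border_sandwich[OF p k(1), of "n - 2 * k" \<rho>] k \<sigma>
      by (auto simp: self_overlapping_iff_border)
  next
    fix \<sigma> assume "\<sigma> \<in> {\<sigma>. self_overlapping n \<sigma>}"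
    then have "self_overlapping n \<sigma>" by simp
    then obtain k \<tau> \<rho> where *: "1 \<le> k" "2 * k \<le> n" "non_self_overlapping k \<tau>"
      "\<rho> permutes {1..n - 2 * k}" and \<sigma>: "\<sigma> = sandwich k (n - 2 * k) \<tau> \<rho>"
      by (rule self_overlapping_eq_sandwich)
    have "(k, \<tau>, \<rho>) \<in> Sigma K A" using * by (simp add: K_def A_def)
    moreover have "\<sigma> = f (k, \<tau>, \<rho>)" using \<sigma> by (simp add: f_def)
    ultimately show "\<sigma> \<in> f ` Sigma K A" by blast
  qed
  ultimately have "num_self_overlapping n = card (Sigma K A)"
    unfolding num_self_overlapping_def by (metis card_image)
  also have "\<dots> = (\<Sum>k\<in>K. card (A k))"
    using finK by (intro card_SigmaI ballI)
      (simp_all add: A_def finite_non_self_overlapping finite_permutations)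
  also have "\<dots> = (\<Sum>k\<in>K. num_non_self_overlapping k * fact (n - 2 * k))"
    by (intro sum.cong refl)
      (simp add: A_def card_cartesian_product card_permutations num_non_self_overlapping_def)
  finally show ?thesis by (simp add: K_def)
qed

lemma num_self_overlapping_add_num_non_self_overlapping:
  assumes "1 \<le> n"
  shows "num_self_overlapping n + num_non_self_overlapping n = fact n"
proof -
  have "{\<sigma>. self_overlapping n \<sigma>} \<union> {\<sigma>. non_self_overlapping n \<sigma>} = {\<sigma>. \<sigma> permutes {1..n}}"
    using assms by (auto simp: self_overlapping_def non_self_overlapping_def)
  moreover have "{\<sigma>. self_overlapping n \<sigma>} \<inter> {\<sigma>. non_self_overlapping n \<sigma>} = {}"
    by (auto simp: non_self_overlapping_def)
  ultimately show ?thesis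
    unfolding num_self_overlapping_def num_non_self_overlapping_def
    using card_Un_disjoint[OF finite_self_overlapping finite_non_self_overlapping, of n n]
      card_permutations[of "{1..n}" n] by simp
qed

section \<open>Generating functions\<close>

lemma fps_nth_compose_X_squared:
  fixes F :: "'a::comm_ring_1 fps"
  shows "fps_nth (fps_compose F (fps_X ^ 2)) n = (if even n then fps_nth F (n div 2) else 0)"
proof -
  have "fps_nth (fps_compose F (fps_X ^ 2)) n = (\<Sum>i\<in>{0..n}. if n = 2 * i then fps_nth F i else 0)"
    by (auto simp: fps_compose_nth power_mult[symmetric] intro!: sum.cong)
  also have "\<dots> = (\<Sum>i\<in>{i \<in> {0..n}. n = 2 * i}. fps_nth F i)"
    by (intro sum.inter_filter[symmetric]) simp
  also have "{i \<in> {0..n}. n = 2 * i} = (if even n then {n div 2} else {})"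
    by auto
  finally show ?thesis by simp
qed

lemma self_overlapping_gf_eq:
  "self_overlapping_gf = fps_compose non_self_overlapping_gf (fps_X ^ 2) * perm_gf"
proof (rule fps_ext)
  fix n :: nat
  let ?N = "non_self_overlapping_gf" and ?N2 = "fps_compose non_self_overlapping_gf (fps_X ^ 2)"
  let ?K = "{k. 1 \<le> k \<and> 2 * k \<le> n}"
  have "fps_nth (?N2 * perm_gf) n = (\<Sum>i=0..n. fps_nth ?N2 i * fact (n - i))"
    by (simp add: fps_mult_nth perm_gf_def)
  also have "\<dots> = (\<Sum>i \<in> (\<lambda>k. 2 * k) ` ?K. fps_nth ?N2 i * fact (n - i))"
  proof (intro sum.mono_neutral_right ballI)
    \<comment> \<open>The remaining indices are the odd ones and \<open>0\<close>, and there is no term for \<open>z\<^sup>0\<close> in \<open>N\<close>.\<close>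
    fix i assume i: "i \<in> {0..n} - (\<lambda>k. 2 * k) ` ?K"
    have "i = 0 \<or> \<not> 2 dvd i"
    proof (rule disjCI)
      assume "\<not> \<not> 2 dvd i"
      then obtain k where "i = 2 * k" by auto
      with i show "i = 0" by auto
    qed
    then show "fps_nth ?N2 i * fact (n - i) = 0"
      by (auto simp: fps_nth_compose_X_squared non_self_overlapping_gf_def)
  qed auto
  also have "\<dots> = (\<Sum>k\<in>?K. of_nat (num_non_self_overlapping k) * fact (n - 2 * k))"
    by (subst sum.reindex) (auto simp: inj_on_def fps_nth_compose_X_squared
        non_self_overlapping_gf_def intro!: sum.cong)
  also have "\<dots> = of_nat (num_self_overlapping n)"
    by (simp add: num_self_overlapping_eq_sum)
  also have "\<dots> = fps_nth self_overlapping_gf n"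
    by (simp add: self_overlapping_gf_def num_self_overlapping_def self_overlapping_def)
  finally show "fps_nth self_overlapping_gf n = fps_nth (?N2 * perm_gf) n" ..
qed

lemma non_self_overlapping_gf_add_self_overlapping_gf:
  "1 + non_self_overlapping_gf + self_overlapping_gf = perm_gf"
proof (rule fps_ext)
  fix n :: nat
  have "of_nat (num_self_overlapping n) + of_nat (num_non_self_overlapping n) = (fact n :: rat)"
    if "1 \<le> n"
    using num_self_overlapping_add_num_non_self_overlapping[OF that]
    by (metis of_nat_add of_nat_fact)
  then show "fps_nth (1 + non_self_overlapping_gf + self_overlapping_gf) n = fps_nth perm_gf n"
    by (simp add: non_self_overlapping_gf_def self_overlapping_gf_def perm_gf_def add.commute)
qed

theorem theorem2p5:
  fixes P S N N2 :: "rat fps"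
  defines "P \<equiv> perm_gf"
    and "S \<equiv> self_overlapping_gf"
    and "N \<equiv> non_self_overlapping_gf"
    and "N2 \<equiv> fps_compose non_self_overlapping_gf (fps_X ^ 2)"
  shows "N = P * (1 - N2) - 1 \<and> S = (1 + N) / (1 - N2) * N2"
proof -
  have S: "S = N2 * P"
    unfolding S_def N2_def P_def by (rule self_overlapping_gf_eq)
  have all: "1 + N + S = P"
    unfolding S_def N_def P_def by (rule non_self_overlapping_gf_add_self_overlapping_gf)
  have N: "1 + N = P * (1 - N2)"
    using S all by (simp add: algebra_simps)
  have "fps_nth N2 0 = 0"
    by (simp add: N2_def non_self_overlapping_gf_def)
  then have "1 - N2 \<noteq> 0" by (metis diff_zero fps_one_nth fps_sub_nth fps_zero_nth zero_neq_one)
  then have "(1 + N) / (1 - N2) = P" unfolding N by simp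
  then have "S = (1 + N) / (1 - N2) * N2" using S by (simp add: mult.commute)
  with N show ?thesis by (simp add: algebra_simps)
qed

end
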